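(* Let $b=\lambda+i\eta$ with $\lambda>0$ and $\eta\in\mathbb{R}$, and for each $n\ge0$ let $$\widehat{U}_n(b;x)=\frac{2^n(\lambda)_n}{\lambda^{n/2}}\,\mathcal{P}_n(b;x/\sqrt{\lambda})\qquad\text{and}\qquad\widetilde{U}_n(b;x)=\frac{(\lambda)_n}{\eta^n\,n!}\,x^n\,\mathcal{P}_n(b;2\eta/x)$$ (with $\eta\ne0$ in the definition of $\widetilde{U}_n$), where $\mathcal{P}_n(b;x)$ are the complementary Romanovski-Routh polynomials. Then the following expansion formulas hold: $$\widehat{U}_n(b;x)=H_n(x)-2\eta n\,H_{n-1}(x)\frac{1}{\sqrt{\lambda}}+\mathcal{O}\big((1/\sqrt{\lambda})^2\big),$$ $$\widetilde{U}_n(b;x)=L_n^{(2\lambda-1)}(x)+\mathcal{O}\big(1/\eta^2\big),$$ where by $\mathcal{O}(h^k)$ we mean powers of $h$ greater than or equal to $k$ (with $h=1/\sqrt{\lambda}$ in the first formula and $h=1/\eta$ in the second).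
   Context: For $b=\lambda+i\eta$ with $\lambda>0$, $\eta\in\mathbb{R}$, the complementary Romanovski-Routh (CRR) polynomials are $\mathcal{P}_n(b;x)=\frac{(2\lambda)_n}{2^n(\lambda)_n}(x-i)^n\,{}_2F_1\!\left(-n,b;b+\overline{b};\frac{-2i}{x-i}\right)$, $n\ge0$, where $(\alpha)_n=\alpha(\alpha+1)\cdots(\alpha+n-1)$. Equivalently, $\mathcal{P}_0(b;x)=1$, $\mathcal{P}_1(b;x)=x-c_1^{(b)}$, and $\mathcal{P}_{n+1}(b;x)=(x-c_{n+1}^{(b)})\mathcal{P}_n(b;x)-d_{n+1}^{(\lambda)}(x^2+1)\mathcal{P}_{n-1}(b;x)$ for $n\ge1$, where $c_n^{(b)}=\frac{\eta}{\lambda+n-1}$ and $d_{n+1}^{(\lambda)}=\frac14\frac{n(n+2\lambda-1)}{(n+\lambda-1)(n+\lambda)}$, $n\ge1$. $H_n$ are the Hermite polynomials: $H_0=1$, $H_1(x)=2x$, $H_{n+1}(x)=2xH_n(x)-2nH_{n-1}(x)$ for $n\ge1$; for $n=0$ the term $nH_{n-1}$ is read as $0$. $L_n^{(\alpha)}$ are the Laguerre polynomials: $L_0^{(\alpha)}=1$, $L_1^{(\alpha)}(x)=\alpha+1-x$, $L_{n+1}^{(\alpha)}(x)=\left(2+\frac{\alpha-1-x}{n+1}\right)L_n^{(\alpha)}(x)-\left(1+\frac{\alpha-1}{n+1}\right)L_{n-1}^{(\alpha)}(x)$ for $n\ge1$. In the first expansion $x$, $n$, $\eta$ are fixed and the expansion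 is in powers of $1/\sqrt{\lambda}$; in the second $x$, $n$, $\lambda$ are fixed and the expansion is in powers of $1/\eta$. The coefficients of these powers do not depend on the expansion variable. For $x=0$, the expression $x^n\mathcal{P}_n(b;2\eta/x)$ is understood as the polynomial in $x$ it defines. *)

theory Defs
  imports "HOL-Analysis.Analysis"
begin

fun Hermite :: "nat \<Rightarrow> real \<Rightarrow> real" where
  "Hermite 0 x = 1"
| "Hermite (Suc 0) x = 2 * x"
| "Hermite (Suc (Suc n)) x = 2 * x * Hermite (Suc n) x - 2 * real (Suc n) * Hermite n x"

fun Laguerre :: "nat \<Rightarrow> real \<Rightarrow> real \<Rightarrow> real" where
  "Laguerre 0 \<alpha> x = 1"
| "Laguerre (Suc 0) \<alpha> x = \<alpha> + 1 - x"
| "Laguerre (Suc (Suc n)) \<alpha> x =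
     (2 + (\<alpha> - 1 - x) / real (Suc (Suc n))) * Laguerre (Suc n) \<alpha> x
     - (1 + (\<alpha> - 1) / real (Suc (Suc n))) * Laguerre n \<alpha> x"

text \<open>
  The complementary Romanovski-Routh polynomial, with \<open>\<lambda> = Re b\<close>. The argument is real, so
  \<open>x - \<i>\<close> never vanishes. The hypergeometric series terminates because its first upper parameter
  is \<open>-n\<close>; the last argument of \<^const>\<open>fps_hypergeo\<close> is a scaling of the variable, here \<open>1\<close>.
  The values are real numbers, but the formula produces them inside \<^typ>\<open>complex\<close>.
\<close>
definition CRR :: "nat \<Rightarrow> complex \<Rightarrow> real \<Rightarrow> complex" where
  "CRR n b x =
     of_real (pochhammer (2 * Re b) n / (2 ^ n * pochhammer (Re b) n))
     * (of_real x - \<i>) ^ n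
     * eval_fps (fps_hypergeo [- of_nat n, b] [b + cnj b] 1) (- 2 * \<i> / (of_real x - \<i>))"

text \<open>
  The polynomial in \<open>x\<close> defined by \<open>x ^ n * P\<^sub>n(b; 2 \<eta> / x)\<close>, \<open>\<eta> = Im b\<close>. It is needed because
  at \<open>x = 0\<close> the expression itself is not usable (\<open>2 \<eta> / 0 = 0\<close> in HOL). Existence and
  uniqueness are established below.
\<close>
definition CRR_rev :: "nat \<Rightarrow> complex \<Rightarrow> complex poly" where
  "CRR_rev n b =
     (THE q. \<forall>x::real. x \<noteq> 0 \<longrightarrow> poly q (of_real x) = of_real x ^ n * CRR n b (2 * Im b / x))"

definition U_hat :: "nat \<Rightarrow> complex \<Rightarrow> real \<Rightarrow> complex" where
  "U_hat n b x =
     of_real (2 ^ n * pochhammer (Re b) n / Re b powr (real n / 2)) * CRR n b (x / sqrt (Re b))"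

definition U_tilde :: "nat \<Rightarrow> complex \<Rightarrow> real \<Rightarrow> complex" where
  "U_tilde n b x =
     of_real (pochhammer (Re b) n / (Im b ^ n * fact n)) * poly (CRR_rev n b) (of_real x)"

lemma real_minus_i_nonzero: "complex_of_real x - \<i> \<noteq> 0"
  by (simp add: complex_eq_iff)

lemma CRR_finite_sum:
  "CRR n b x =
     of_real (pochhammer (2 * Re b) n / (2 ^ n * pochhammer (Re b) n))
     * (\<Sum>k\<le>n. pochhammer (- of_nat n) k * pochhammer b k
                 / (pochhammer (b + cnj b) k * fact k) * (- 2 * \<i>) ^ k
                 * (of_real x - \<i>) ^ (n - k))"
proof -
  let ?z = "- 2 * \<i> / (complex_of_real x - \<i>)"
  let ?a = "\<lambda>k. pochhammer (- of_nat n) k * pochhammer b k / (pochhammer (b + cnj b) k * fact k)"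
  have "eval_fps (fps_hypergeo [- of_nat n, b] [b + cnj b] 1) ?z = (\<Sum>k. ?a k * ?z ^ k)"
    by (simp add: eval_fps_def)
  also have "\<dots> = (\<Sum>k\<le>n. ?a k * ?z ^ k)"
    by (rule suminf_finite) (auto simp: pochhammer_of_nat_eq_0_iff)
  finally have "(of_real x - \<i>) ^ n * eval_fps (fps_hypergeo [- of_nat n, b] [b + cnj b] 1) ?z
      = (\<Sum>k\<le>n. (of_real x - \<i>) ^ n * (?a k * ?z ^ k))"
    by (simp add: sum_distrib_left)
  also have "\<dots> = (\<Sum>k\<le>n. ?a k * (- 2 * \<i>) ^ k * (of_real x - \<i>) ^ (n - k))"
  proof (intro sum.cong refl)
    fix k assume "k \<in> {..n}"
    then have "k \<le> n" by simp
    have "(complex_of_real x - \<i>) ^ n * ?z ^ k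
        = (- 2 * \<i>) ^ k * ((complex_of_real x - \<i>) ^ n / (complex_of_real x - \<i>) ^ k)"
      unfolding power_divide by (simp only: times_divide_eq_right mult.commute)
    then have *: "(complex_of_real x - \<i>) ^ n * ?z ^ k
        = (- 2 * \<i>) ^ k * (complex_of_real x - \<i>) ^ (n - k)"
      unfolding power_diff[OF real_minus_i_nonzero \<open>k \<le> n\<close>] .
    show "(of_real x - \<i>) ^ n * (?a k * ?z ^ k)
        = ?a k * (- 2 * \<i>) ^ k * (of_real x - \<i>) ^ (n - k)"
      unfolding mult.left_commute[of _ "?a k"] * by (rule mult.assoc[symmetric])
  qed
  finally show ?thesis
    by (simp add: CRR_def mult.assoc)
qed

lemma CRR_rev_ex1:
  "\<exists>!q. \<forall>x::real. x \<noteq> 0 \<longrightarrow> poly q (of_real x) = of_real x ^ n * CRR n b (2 * Im b / x)"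
proof (rule ex_ex1I)
  let ?c = "complex_of_real (pochhammer (2 * Re b) n / (2 ^ n * pochhammer (Re b) n))"
  let ?a = "\<lambda>k. pochhammer (- of_nat n) k * pochhammer b k / (pochhammer (b + cnj b) k * fact k)
                * (- 2 * \<i>) ^ k"
  let ?q = "smult ?c (\<Sum>k\<le>n. smult (?a k) (monom 1 k * [:of_real (2 * Im b), - \<i>:] ^ (n - k)))"
  have "poly ?q (of_real x) = of_real x ^ n * CRR n b (2 * Im b / x)" if x: "x \<noteq> 0" for x :: real
  proof -
    have *: "of_real x ^ n * (complex_of_real (2 * Im b / x) - \<i>) ^ (n - k)
        = of_real x ^ k * (of_real (2 * Im b) - \<i> * of_real x) ^ (n - k)" if "k \<le> n" for k
    proof -
      have "of_real x ^ n = complex_of_real x ^ k * of_real x ^ (n - k)"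
        using that by (simp flip: power_add)
      moreover have "of_real x * (complex_of_real (2 * Im b / x) - \<i>)
          = of_real (2 * Im b) - \<i> * of_real x"
        using x by (simp add: field_simps)
      ultimately show ?thesis
        by (metis (no_types, lifting) mult.assoc power_mult_distrib)
    qed
    have "of_real x ^ n * CRR n b (2 * Im b / x)
        = ?c * (\<Sum>k\<le>n. ?a k * (of_real x ^ n * (of_real (2 * Im b / x) - \<i>) ^ (n - k)))"
      unfolding CRR_finite_sum sum_distrib_left by (intro sum.cong refl) (simp add: mult_ac)
    also have "\<dots> = ?c * (\<Sum>k\<le>n. ?a k *
        (of_real x ^ k * (of_real (2 * Im b) - \<i> * of_real x) ^ (n - k)))"
      by (rule arg_cong[where f = "\<lambda>s. ?c * s"], rule sum.cong[OF refl], simp only: * atMost_iff)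
    also have "\<dots> = poly ?q (of_real x)"
      by (simp add: poly_sum poly_monom mult.commute)
    finally show ?thesis ..
  qed
  then show "\<exists>q. \<forall>x::real. x \<noteq> 0 \<longrightarrow>
      poly q (of_real x) = of_real x ^ n * CRR n b (2 * Im b / x)"
    by blast
next
  fix p q :: "complex poly"
  assume p: "\<forall>x::real. x \<noteq> 0 \<longrightarrow> poly p (of_real x) = of_real x ^ n * CRR n b (2 * Im b / x)"
    and q: "\<forall>x::real. x \<noteq> 0 \<longrightarrow> poly q (of_real x) = of_real x ^ n * CRR n b (2 * Im b / x)"
  have "complex_of_real ` {0<..} \<subseteq> {z. poly (p - q) z = 0}"
    using p q by auto
  moreover have "infinite (complex_of_real ` {0<..})"
    by (simp add: finite_image_iff inj_on_def infinite_Ioi)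
  ultimately have "infinite {z. poly (p - q) z = 0}"
    using finite_subset by blast
  then show "p = q"
    using poly_roots_finite[of "p - q"] by auto
qed

lemma poly_CRR_rev:
  "x \<noteq> 0 \<Longrightarrow> poly (CRR_rev n b) (of_real x) = of_real x ^ n * CRR n b (2 * Im b / x)"
  using theI'[OF CRR_rev_ex1[of n b]] unfolding CRR_rev_def by blast

end

theory Submission
  imports Defs
begin

text \<open>
  Put \<open>S\<^sub>n(y) = 2\<^sup>n (\<lambda>)\<^sub>n P\<^sub>n(b; y) / n!\<close>. With this normalisation the hypergeometric sum has the
  generating function
  \<open>\<Sum>\<^sub>n S\<^sub>n(y) t\<^sup>n = (1 - (y + \<i>) t) powr (- b) * (1 - (y - \<i>) t) powr (- cnj b)\<close>, and the first-order
  differential equation that it satisfies in \<open>t\<close> is the three-term recurrence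
  \<open>(n + 2) S\<^sub>n\<^sub>+\<^sub>2 = (2 (n + 1 + \<lambda>) y - 2 \<eta>) S\<^sub>n\<^sub>+\<^sub>1 - (n + 2 \<lambda>) (y\<^sup>2 + 1) S\<^sub>n\<close>.
  The recurrence is a polynomial identity that already holds summand by summand, so it is proved
  here from the coefficients, without the generating function (\<open>binomial_conv_rec\<close>, \<open>CRR_scaled_rec\<close>).

  Both families of the theorem are rescalings of \<open>S\<^sub>n\<close>. Rescaling turns the recurrence into one
  whose coefficients are polynomials in \<open>h = 1 / \<surd>\<lambda>\<close>, respectively in \<open>h = 1 / \<eta>\<close>
  (\<open>U_hat_rec\<close>, \<open>U_tilde_rec\<close>): for \<open>U_hat\<close> the factor \<open>\<lambda>\<close> in \<open>(n + 2 \<lambda>) h\<^sup>2\<close> is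
  absorbed by \<open>h\<^sup>2 = 1 / \<lambda>\<close>, and for \<open>U_tilde\<close> only the even power \<open>h\<^sup>2\<close> occurs. Hence both
  families are polynomials in \<open>h\<close>, and only their two lowest coefficients are to be found.
  Modulo \<open>h\<^sup>2\<close> the two recurrences are
  \<open>u\<^sub>n\<^sub>+\<^sub>2 = (2 x - 2 \<eta> h) u\<^sub>n\<^sub>+\<^sub>1 - 2 (n + 1) u\<^sub>n\<close> and the Laguerre recurrence with
  \<open>\<alpha> = 2 \<lambda> - 1\<close>. The first one is the Hermite recurrence at \<open>x - \<eta> h\<close>, whose solution is
  \<open>H\<^sub>n(x) - \<eta> h H\<^sub>n'(x) = H\<^sub>n(x) - 2 n \<eta> h H\<^sub>n\<^sub>-\<^sub>1(x)\<close> modulo \<open>h\<^sup>2\<close>.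
\<close>

section \<open>The three-term recurrence\<close>

text \<open>The coefficient of \<open>t ^ m\<close> in \<open>(1 - t) powr (- a)\<close>.\<close>
definition rising_binomial :: "'a::field_char_0 \<Rightarrow> nat \<Rightarrow> 'a" where
  "rising_binomial a m = pochhammer a m / fact m"

lemma rising_binomial_0 [simp]: "rising_binomial a 0 = 1"
  by (simp add: rising_binomial_def)

lemma rising_binomial_Suc:
  "rising_binomial a (Suc m) = rising_binomial a m * (a + of_nat m) / (of_nat m + 1)"
  by (simp add: rising_binomial_def pochhammer_Suc add.commute mult.commute)

lemma rising_binomial_Suc_left:
  "rising_binomial a (Suc m) = rising_binomial (a + 1) m * a / (of_nat m + 1)"
  by (simp add: rising_binomial_def pochhammer_rec add.commute mult.commute)

text \<open>
  The sum \<open>\<Sum>k\<le>n. binomial_term b c s w n k\<close> is the coefficient of \<open>t ^ n\<close> in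
  \<open>(1 - (w + s) t) powr (- b) * (1 - w t) powr (b - c)\<close>, expanded in powers of \<open>s\<close>. The value
  \<open>0\<close> beyond \<open>k = n\<close> lets sums for neighbouring \<open>n\<close> run over the same range.
\<close>
definition binomial_term :: "'a::field_char_0 \<Rightarrow> 'a \<Rightarrow> 'a \<Rightarrow> 'a \<Rightarrow> nat \<Rightarrow> nat \<Rightarrow> 'a" where
  "binomial_term b c s w n k =
     (if k \<le> n
      then rising_binomial b k * s ^ k * (rising_binomial (c + of_nat k) (n - k) * w ^ (n - k))
      else 0)"

lemma of_nat_plus_nonzero:
  "of_nat m + 1 \<noteq> (0::'a::field_char_0)" "of_nat m + 2 \<noteq> (0::'a)"
  by (metis of_nat_1 of_nat_add of_nat_eq_0_iff add_is_0 one_neq_zero,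
      metis of_nat_numeral of_nat_add of_nat_eq_0_iff add_is_0 zero_neq_numeral)

lemma binomial_term_rec_0:
  "(of_nat n + 2) * binomial_term b c s w (n + 2) 0
     = (2 * (of_nat n + 1) + c) * w * binomial_term b c s w (n + 1) 0
       - (of_nat n + c) * w\<^sup>2 * binomial_term b c s w n 0"
proof -
  have "(N + 2) * (T * (c + N) / (N + 1) * (c + (1 + N)) / (1 + N + 1) * (w * (w * W)))
      = (2 * (N + 1) + c) * w * (T * (c + N) / (N + 1) * (w * W)) - (N + c) * w\<^sup>2 * (T * W)"
    if "N + 1 \<noteq> 0" "N + 2 \<noteq> 0" for N T W :: 'a
  proof -
    have "1 + N + 1 = N + 2" by simp
    then show ?thesis
      using that by (simp only:) (simp add: divide_simps, simp add: algebra_simps power2_eq_square)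
  qed
  from this[OF of_nat_plus_nonzero] show ?thesis
    by (simp add: binomial_term_def rising_binomial_Suc)
qed

text \<open>
  Multiplied by its coefficient, each of the five terms is, for \<open>k < n\<close>, a rational multiple of
  one product of Pochhammer symbols and powers, so that the claim is a rational identity in \<open>b\<close>,
  \<open>c\<close>, \<open>k\<close> and \<open>n\<close>. For \<open>k = n\<close> and \<open>k = n + 1\<close> some of the terms vanish because their last
  index exceeds the one before it, and the rest balances.
\<close>
lemma binomial_term_rec_Suc:
  assumes "k \<le> n + 1"
  shows "(of_nat n + 2) * binomial_term b c s w (n + 2) (Suc k)
     = (2 * (of_nat n + 1) + c) * w * binomial_term b c s w (n + 1) (Suc k)
       + (of_nat n + 1 + b) * s * binomial_term b c s w (n + 1) k
       - (of_nat n + c) * w\<^sup>2 * binomial_term b c s w n (Suc k)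
       - (of_nat n + c) * w * s * binomial_term b c s w n k"
proof -
  define B where "B = rising_binomial b k * s ^ k"
  define K where "K = (of_nat k :: 'a)"
  have K: "K + 1 \<noteq> 0" unfolding K_def by (rule of_nat_plus_nonzero)
  have B': "rising_binomial b (Suc k) * s ^ Suc k = B * s * (b + K) / (K + 1)"
    by (simp add: B_def K_def rising_binomial_Suc)
  consider "k = n + 1" | "k = n" | m where "n = Suc k + m"
    using assms by (metis Suc_eq_plus1 le_SucE le_neq_implies_less less_natE add_Suc)
  then show ?thesis
  proof cases
    case 1
    have N: "of_nat n = K - 1" using 1 by (simp add: K_def)
    show ?thesis
      unfolding N using K 1 B' B_def by (simp add: binomial_term_def field_simps del: power_Suc)
  next
    case 2
    have N: "of_nat n = K" using 2 by (simp add: K_def)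
    have t: "binomial_term b c s w (n + 2) (Suc k) = B * s * (b + K) / (K + 1) * ((c + K + 1) * w)"
      "binomial_term b c s w (n + 1) (Suc k) = B * s * (b + K) / (K + 1)"
      "binomial_term b c s w (n + 1) k = B * ((c + K) * w)"
      "binomial_term b c s w n (Suc k) = 0"
      "binomial_term b c s w n k = B"
      using 2 B'
      by (simp_all add: binomial_term_def B_def K_def rising_binomial_def add_ac del: power_Suc)
    show ?thesis
      unfolding t N using K by (simp add: divide_simps) (simp add: algebra_simps)
  next
    case (3 m)
    define M where "M = (of_nat m :: 'a)"
    define T where "T = rising_binomial (c + K + 1) m * w ^ m"
    have M: "M + 1 \<noteq> 0" "M + 2 \<noteq> 0" unfolding M_def by (rule of_nat_plus_nonzero)+
    have N: "of_nat n = K + 1 + M" using 3 by (simp add: K_def M_def)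
    have d: "n + 2 - Suc k = Suc (Suc m)" "n + 1 - Suc k = Suc m" "n + 1 - k = Suc (Suc m)"
      "n - Suc k = m" "n - k = Suc m"
      using 3 by simp_all
    have k: "c + of_nat (Suc k) = c + K + 1" "c + of_nat k = c + K"
      by (simp_all add: K_def)
    have r: "rising_binomial (c + K) (Suc m) = rising_binomial (c + K + 1) m * (c + K) / (M + 1)"
      "rising_binomial (c + K) (Suc (Suc m))
         = rising_binomial (c + K + 1) m * (c + K) * (c + K + 1 + M) / ((M + 1) * (M + 2))"
      "rising_binomial (c + K + 1) (Suc m)
         = rising_binomial (c + K + 1) m * (c + K + 1 + M) / (M + 1)"
      "rising_binomial (c + K + 1) (Suc (Suc m)) = rising_binomial (c + K + 1) m
         * (c + K + 1 + M) * (c + K + 2 + M) / ((M + 1) * (M + 2))"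
      unfolding rising_binomial_Suc_left[of "c + K"]
      by (simp_all add: rising_binomial_Suc M_def add_ac mult_ac)
    have t: "binomial_term b c s w (n + 2) (Suc k) = B * s * (b + K) / (K + 1)
          * (T * w\<^sup>2 * (c + K + 1 + M) * (c + K + 2 + M) / ((M + 1) * (M + 2)))"
      "binomial_term b c s w (n + 1) (Suc k) = B * s * (b + K) / (K + 1)
          * (T * w * (c + K + 1 + M) / (M + 1))"
      "binomial_term b c s w (n + 1) k
          = B * (T * w\<^sup>2 * (c + K) * (c + K + 1 + M) / ((M + 1) * (M + 2)))"
      "binomial_term b c s w n (Suc k) = B * s * (b + K) / (K + 1) * T"
      "binomial_term b c s w n k = B * (T * w * (c + K) / (M + 1))"
      using 3 unfolding binomial_term_def d k B' B_def[symmetric] r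
      by (simp_all add: T_def power2_eq_square)
    show ?thesis
      unfolding t N using K M by (simp add: divide_simps) (simp add: algebra_simps power2_eq_square)
  qed
qed

lemma binomial_conv_rec:
  fixes b c s w :: "'a::field_char_0"
  defines "Q \<equiv> \<lambda>n. \<Sum>k\<le>n. binomial_term b c s w n k"
  shows "(of_nat n + 2) * Q (n + 2)
     = ((of_nat n + 1) * (2 * w + s) + b * s + c * w) * Q (n + 1)
       - (of_nat n + c) * (w * (w + s)) * Q n"
proof -
  let ?t = "binomial_term b c s w"
  have shift: "Q m = ?t m 0 + (\<Sum>k\<le>n + 1. ?t m (Suc k))" if "m \<le> n + 2" for m
  proof -
    have "Q m = (\<Sum>k\<le>Suc (n + 1). ?t m k)"
      unfolding Q_def using that by (intro sum.mono_neutral_left) (auto simp: binomial_term_def)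
    then show ?thesis by (simp only: sum.atMost_Suc_shift)
  qed
  have extend: "Q m = (\<Sum>k\<le>n + 1. ?t m k)" if "m \<le> n + 1" for m
    unfolding Q_def using that by (intro sum.mono_neutral_left) (auto simp: binomial_term_def)
  let ?S = "\<lambda>m. \<Sum>k\<le>n + 1. ?t m (Suc k)"
  have "(of_nat n + 2) * ?S (n + 2)
      = (\<Sum>k\<le>n + 1. (2 * (of_nat n + 1) + c) * w * ?t (n + 1) (Suc k)
           + (of_nat n + 1 + b) * s * ?t (n + 1) k
           - (of_nat n + c) * w\<^sup>2 * ?t n (Suc k)
           - (of_nat n + c) * w * s * ?t n k)"
    unfolding sum_distrib_left by (intro sum.cong refl binomial_term_rec_Suc) simp
  also have "\<dots> = (2 * (of_nat n + 1) + c) * w * ?S (n + 1)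
      + (of_nat n + 1 + b) * s * Q (n + 1)
      - (of_nat n + c) * w\<^sup>2 * ?S n
      - (of_nat n + c) * w * s * Q n"
    using extend[of "n + 1"] extend[of n]
    by (simp only: sum.distrib sum_subtractf flip: sum_distrib_left)
  finally have S: "(of_nat n + 2) * ?S (n + 2) = \<dots>" .
  have "(of_nat n + 2) * Q (n + 2) = (of_nat n + 2) * ?t (n + 2) 0 + (of_nat n + 2) * ?S (n + 2)"
    by (simp only: shift[OF order_refl] distrib_left)
  also have "\<dots> = (2 * (of_nat n + 1) + c) * w * (?t (n + 1) 0 + ?S (n + 1))
        + (of_nat n + 1 + b) * s * Q (n + 1)
        - (of_nat n + c) * w\<^sup>2 * (?t n 0 + ?S n)
        - (of_nat n + c) * w * s * Q n"
    unfolding S binomial_term_rec_0 by (simp only: algebra_simps)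
  also have "?t (n + 1) 0 + ?S (n + 1) = Q (n + 1)"
    by (rule shift[symmetric]) simp
  also have "?t n 0 + ?S n = Q n"
    by (rule shift[symmetric]) simp
  finally show ?thesis
    by (simp add: algebra_simps power2_eq_square)
qed

text \<open>The \<open>S\<^sub>n\<close> of the introduction, for \<open>\<lambda> = Re b\<close>.\<close>
definition CRR_scaled :: "nat \<Rightarrow> complex \<Rightarrow> real \<Rightarrow> complex" where
  "CRR_scaled n b y = of_real (2 ^ n * pochhammer (Re b) n / fact n) * CRR n b y"

text \<open>
  The quotients \<open>(2 \<lambda>)\<^sub>n / (2 \<lambda>)\<^sub>k = (2 \<lambda> + k)\<^sub>n\<^sub>-\<^sub>k\<close> remove the denominator parameter of the
  hypergeometric sum, and \<open>(- n)\<^sub>k / n!\<close> becomes \<open>(- 1)\<^sup>k / (n - k)!\<close>; what remains are the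
  coefficients of the generating function, with \<open>w = y - \<i>\<close> and \<open>w + s = y + \<i>\<close>.
\<close>
lemma CRR_scaled_eq_sum:
  assumes "Re b > 0"
  shows "CRR_scaled n b y
     = (\<Sum>k\<le>n. binomial_term b (of_real (2 * Re b)) (2 * \<i>) (of_real y - \<i>) n k)"
proof -
  have poch: "pochhammer (Re b) n \<noteq> 0" "\<And>k. pochhammer (2 * complex_of_real (Re b)) k \<noteq> 0"
  proof -
    show "pochhammer (Re b) n \<noteq> 0" using pochhammer_pos[OF assms, of n] by simp
    have "pochhammer (2 * Re b) k \<noteq> 0" for k using pochhammer_pos[of "2 * Re b" k] assms by simp
    then show "pochhammer (2 * complex_of_real (Re b)) k \<noteq> 0" for k
      by (metis of_real_eq_0_iff of_real_mult of_real_numeral pochhammer_of_real)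
  qed
  have neg: "pochhammer (- of_nat n :: complex) k = (- 1) ^ k * fact n / fact (n - k)" if "k \<le> n" for k
  proof -
    have "(of_nat n gchoose k :: complex) = fact n / (fact k * fact (n - k))"
      using that by (simp add: binomial_fact flip: binomial_gbinomial)
    then have "(- 1) ^ k * pochhammer (- of_nat n :: complex) k = fact n / fact (n - k)"
      unfolding gbinomial_pochhammer by (simp add: field_simps)
    moreover have "pochhammer (- of_nat n :: complex) k
        = (- 1) ^ k * ((- 1) ^ k * pochhammer (- of_nat n) k)"
      by (simp flip: mult.assoc power_mult_distrib)
    ultimately show ?thesis by simp
  qed
  have "CRR_scaled n b y = (\<Sum>k\<le>n. of_real (pochhammer (2 * Re b) n / fact n)
      * (pochhammer (- of_nat n) k * pochhammer b k
         / (pochhammer (of_real (2 * Re b)) k * fact k) * (- 2 * \<i>) ^ k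
         * (of_real y - \<i>) ^ (n - k)))"
    unfolding CRR_scaled_def CRR_finite_sum complex_add_cnj sum_distrib_left[symmetric]
    using poch(1) by simp
  also have "\<dots> = (\<Sum>k\<le>n. binomial_term b (of_real (2 * Re b)) (2 * \<i>) (of_real y - \<i>) n k)"
  proof (intro sum.cong refl)
    fix k assume "k \<in> {..n}"
    then have k: "k \<le> n" by simp
    have p: "complex_of_real (pochhammer (2 * Re b) n)
        = pochhammer (of_real (2 * Re b)) k * pochhammer (of_real (2 * Re b) + of_nat k) (n - k)"
      using pochhammer_product[OF k, of "complex_of_real (2 * Re b)"]
      by (simp only: pochhammer_of_real)
    have sgn: "(- 1) ^ k * (- 2 * \<i>) ^ k = (2 * \<i>) ^ k"
      by (simp only: power_mult_distrib[symmetric]) simp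
    show "of_real (pochhammer (2 * Re b) n / fact n)
      * (pochhammer (- of_nat n) k * pochhammer b k
         / (pochhammer (of_real (2 * Re b)) k * fact k) * (- 2 * \<i>) ^ k
         * (of_real y - \<i>) ^ (n - k))
      = binomial_term b (of_real (2 * Re b)) (2 * \<i>) (of_real y - \<i>) n k"
      unfolding neg[OF k] of_real_divide p binomial_term_def rising_binomial_def sgn[symmetric]
      using k poch(2)[of k] by (simp add: field_simps)
  qed
  finally show ?thesis .
qed

lemma CRR_scaled_0: "CRR_scaled 0 b y = 1"
  by (simp add: CRR_scaled_def CRR_finite_sum)

lemma CRR_scaled_1:
  assumes "Re b > 0"
  shows "CRR_scaled 1 b y = of_real (2 * (Re b * y - Im b))"
  unfolding CRR_scaled_eq_sum[OF assms]
  by (simp add: binomial_term_def rising_binomial_def complex_eq_iff algebra_simps)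

lemma CRR_scaled_rec:
  assumes "Re b > 0"
  shows "(of_nat n + 2) * CRR_scaled (n + 2) b y
     = of_real (2 * ((real n + 1 + Re b) * y - Im b)) * CRR_scaled (n + 1) b y
       - of_real ((real n + 2 * Re b) * (y\<^sup>2 + 1)) * CRR_scaled n b y"
proof -
  let ?w = "complex_of_real y - \<i>" and ?c = "complex_of_real (2 * Re b)"
  have "(of_nat n + 1) * (2 * ?w + 2 * \<i>) + b * (2 * \<i>) + ?c * ?w
      = of_real (2 * ((real n + 1 + Re b) * y - Im b))"
    by (simp add: complex_eq_iff algebra_simps)
  moreover have "(of_nat n + ?c) * (?w * (?w + 2 * \<i>)) = of_real ((real n + 2 * Re b) * (y\<^sup>2 + 1))"
    by (simp add: complex_eq_iff algebra_simps power2_eq_square)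
  ultimately show ?thesis
    using binomial_conv_rec[of n b ?c "2 * \<i>" ?w] unfolding CRR_scaled_eq_sum[OF assms] by simp
qed

section \<open>The expansion in powers of \<open>1 / \<surd>\<lambda>\<close>\<close>

lemma U_hat_eq_CRR_scaled:
  assumes "Re b > 0"
  defines "h \<equiv> 1 / sqrt (Re b)"
  shows "U_hat n b x = of_real (fact n * h ^ n) * CRR_scaled n b (x * h)"
proof -
  have "Re b powr (real n / 2) = sqrt (Re b) ^ n"
    using powr_powr[of "Re b" "1 / 2" "real n"] assms(1) by (simp add: powr_half_sqrt powr_realpow)
  then show ?thesis
    by (simp add: U_hat_def CRR_scaled_def h_def power_one_over divide_simps)
qed

lemma U_hat_rec:
  assumes "Re b > 0"
  defines "h \<equiv> 1 / sqrt (Re b)"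
  shows "U_hat (n + 2) b x
     = of_real (2 * x * (1 + (real n + 1) * h\<^sup>2) - 2 * Im b * h) * U_hat (n + 1) b x
       - of_real ((real n + 1) * (2 + real n * h\<^sup>2) * (1 + x\<^sup>2 * h\<^sup>2)) * U_hat n b x"
proof -
  \<comment> \<open>This relation is what eliminates \<open>\<lambda>\<close> from both coefficients.\<close>
  have h: "h\<^sup>2 * Re b = 1"
    using assms by (simp add: power_one_over)
  let ?S = "\<lambda>m. CRR_scaled m b (x * h)"
  have c1: "h * (2 * ((real n + 1 + Re b) * (x * h) - Im b))
      = 2 * x * (1 + (real n + 1) * h\<^sup>2) - 2 * Im b * h"
    using h by algebra
  have c0: "h\<^sup>2 * ((real n + 2 * Re b) * ((x * h)\<^sup>2 + 1)) = (2 + real n * h\<^sup>2) * (1 + x\<^sup>2 * h\<^sup>2)"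
    using h by algebra
  have "U_hat (n + 2) b x = of_real (fact (n + 1) * h ^ (n + 2)) * ((of_nat n + 2) * ?S (n + 2))"
    unfolding U_hat_eq_CRR_scaled[OF assms(1)] h_def[symmetric] by (simp add: algebra_simps)
  also have "\<dots> = of_real (h * (2 * ((real n + 1 + Re b) * (x * h) - Im b)))
        * (of_real (fact (n + 1) * h ^ (n + 1)) * ?S (n + 1))
      - of_real ((real n + 1) * (h\<^sup>2 * ((real n + 2 * Re b) * ((x * h)\<^sup>2 + 1))))
        * (of_real (fact n * h ^ n) * ?S n)"
    unfolding CRR_scaled_rec[OF assms(1)] by (simp add: algebra_simps power2_eq_square)
  finally show ?thesis
    unfolding c1 c0 U_hat_eq_CRR_scaled[OF assms(1)] h_def[symmetric] by (simp only: mult.assoc)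
qed

text \<open>
  In \<open>U_hat_rec\<close> the parameter \<open>\<lambda>\<close> enters only through \<open>h\<close>, so these polynomials do not depend
  on \<open>\<lambda>\<close>. That makes the remainder of the expansion the same for all \<open>\<lambda> > 0\<close>.
\<close>
fun hat_poly :: "real \<Rightarrow> real \<Rightarrow> nat \<Rightarrow> real poly" where
  "hat_poly \<eta> x 0 = 1"
| "hat_poly \<eta> x (Suc 0) = [:2 * x, - 2 * \<eta>:]"
| "hat_poly \<eta> x (Suc (Suc n)) =
     [:2 * x, - 2 * \<eta>, 2 * x * (real n + 1):] * hat_poly \<eta> x (Suc n)
     - smult (real n + 1) ([:2, 0, real n:] * ([:1, 0, x\<^sup>2:] * hat_poly \<eta> x n))"

lemma U_hat_eq_poly:
  assumes "lam > 0"
  shows "U_hat n (Complex lam \<eta>) x = of_real (poly (hat_poly \<eta> x n) (1 / sqrt lam))"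
  using assms
proof (induction \<eta> x n rule: hat_poly.induct)
  case (1 \<eta> x)
  then show ?case by (simp add: U_hat_eq_CRR_scaled CRR_scaled_0)
next
  case (2 \<eta> x)
  define h where "h = 1 / sqrt lam"
  have "h * h * lam = 1" using 2 by (simp add: h_def)
  then have "h * (2 * (lam * (x * h) - \<eta>)) = 2 * x - 2 * \<eta> * h" by algebra
  then have "U_hat 1 (Complex lam \<eta>) x = of_real (2 * x - 2 * \<eta> * h)"
    using 2 U_hat_eq_CRR_scaled[of "Complex lam \<eta>" 1 x] CRR_scaled_1[of "Complex lam \<eta>" "x * h"]
    by (simp only: h_def[symmetric] complex.sel fact_1 power_one_right mult_1 flip: of_real_mult)
  then show ?case
    by (simp add: h_def algebra_simps)
next
  case (3 \<eta> x n)
  have rec: "poly (hat_poly \<eta> x (Suc (Suc n))) h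
      = (2 * x * (1 + (real n + 1) * h\<^sup>2) - 2 * \<eta> * h) * poly (hat_poly \<eta> x (Suc n)) h
        - (real n + 1) * (2 + real n * h\<^sup>2) * (1 + x\<^sup>2 * h\<^sup>2) * poly (hat_poly \<eta> x n) h" for h
    by (simp add: algebra_simps power2_eq_square)
  then show ?case
    using U_hat_rec[of "Complex lam \<eta>" n x] 3 unfolding rec by (simp del: hat_poly.simps)
qed

lemma coeff_hat_poly_0: "coeff (hat_poly \<eta> x n) 0 = Hermite n x"
  by (induction \<eta> x n rule: hat_poly.induct) (simp_all add: coeff_mult_0 algebra_simps)

text \<open>
  The linear coefficients \<open>a\<^sub>n\<close> satisfy \<open>a\<^sub>n\<^sub>+\<^sub>2 = 2 x a\<^sub>n\<^sub>+\<^sub>1 - 2 \<eta> H\<^sub>n\<^sub>+\<^sub>1 - 2 (n + 1) a\<^sub>n\<close>. The claim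
  at \<open>n\<close> and \<open>n + 1\<close> turns the first and last summands into \<open>- 2 \<eta> (n + 1)\<close> times the right-hand
  side of the Hermite recurrence for \<open>H\<^sub>n\<^sub>+\<^sub>1\<close>, and the middle summand raises the factor \<open>n + 1\<close>
  to \<open>n + 2\<close>.
\<close>
lemma coeff_hat_poly_1: "coeff (hat_poly \<eta> x n) 1 = - 2 * \<eta> * real n * Hermite (n - 1) x"
proof (induction \<eta> x n rule: hat_poly.induct)
  case (3 \<eta> x n)
  have "coeff (hat_poly \<eta> x (Suc (Suc n))) 1
      = 2 * x * coeff (hat_poly \<eta> x (Suc n)) 1 - 2 * \<eta> * coeff (hat_poly \<eta> x (Suc n)) 0
        - 2 * (real n + 1) * coeff (hat_poly \<eta> x n) 1"
    by simp
  also have "\<dots> = - 2 * \<eta> * real (n + 2) * Hermite (n + 1) x"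
    unfolding 3 coeff_hat_poly_0 by (cases n) (simp_all add: algebra_simps)
  finally show ?case by simp
qed simp_all

section \<open>The expansion in powers of \<open>1 / \<eta>\<close>\<close>

text \<open>
  The reversed polynomial is given by the values of \<open>CRR\<close> only off the origin; identities for it
  extend to the origin by continuity.
\<close>
lemma eq_everywhere_if_eq_off_0:
  fixes f g :: "real \<Rightarrow> complex"
  assumes "isCont f 0" "isCont g 0" "\<And>x. x \<noteq> 0 \<Longrightarrow> f x = g x"
  shows "f x = g x"
proof (cases "x = 0")
  case True
  have "(f \<longlongrightarrow> g 0) (at 0)"
    using assms(2) unfolding isCont_def
    by (rule Lim_transform_eventually) (auto simp: eventually_at_filter assms(3))
  then have "f 0 = g 0"
    using assms(1) unfolding isCont_def by (rule tendsto_unique[OF at_neq_bot, rotated])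
  then show ?thesis by (simp add: True)
qed (use assms(3) in auto)

lemma isCont_U_tilde [continuous_intros]: "isCont (U_tilde n b) x"
  unfolding U_tilde_def by (intro continuous_intros)

lemma U_tilde_eq_CRR_scaled:
  assumes "x \<noteq> 0"
  shows "U_tilde n b x = of_real ((x / (2 * Im b)) ^ n) * CRR_scaled n b (2 * Im b / x)"
  unfolding U_tilde_def CRR_scaled_def poly_CRR_rev[OF assms]
  by (simp add: power_divide power_mult_distrib)

lemma U_tilde_0: "U_tilde 0 b x = 1"
  by (rule eq_everywhere_if_eq_off_0[where f = "U_tilde 0 b"])
    (auto simp: U_tilde_eq_CRR_scaled CRR_scaled_0 intro: isCont_U_tilde)

lemma U_tilde_1:
  assumes "Re b > 0" "Im b \<noteq> 0"
  shows "U_tilde 1 b x = of_real (2 * Re b - x)"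
proof (rule eq_everywhere_if_eq_off_0[where f = "U_tilde 1 b"])
  show "U_tilde 1 b x = of_real (2 * Re b - x)" if "x \<noteq> 0" for x
    unfolding U_tilde_eq_CRR_scaled[OF that] CRR_scaled_1[OF assms(1)]
    unfolding of_real_mult[symmetric] of_real_eq_iff using assms(2) that by (simp add: field_simps)
qed (intro continuous_intros)+

lemma U_tilde_rec:
  assumes "Re b > 0" "Im b \<noteq> 0"
  shows "(of_nat n + 2) * U_tilde (n + 2) b x
     = of_real (2 * (real n + 1 + Re b) - x) * U_tilde (n + 1) b x
       - of_real ((real n + 2 * Re b) * (1 + (x / 2)\<^sup>2 * (1 / Im b)\<^sup>2)) * U_tilde n b x"
proof (rule eq_everywhere_if_eq_off_0[where f = "\<lambda>x. (of_nat n + 2) * U_tilde (n + 2) b x"])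
  fix x :: real assume x: "x \<noteq> 0"
  define r where "r = x / (2 * Im b)"
  let ?y = "2 * Im b / x"
  let ?S = "\<lambda>m. CRR_scaled m b ?y"
  have ry: "r * ?y = 1" "2 * Im b * r = x" using x assms(2) by (simp_all add: r_def)
  have c1: "r * (2 * ((real n + 1 + Re b) * ?y - Im b)) = 2 * (real n + 1 + Re b) - x"
    using ry by algebra
  have "(x / 2)\<^sup>2 * (1 / Im b)\<^sup>2 = r\<^sup>2"
    by (simp add: r_def power_divide power_mult_distrib)
  then have c0: "r\<^sup>2 * ((real n + 2 * Re b) * (?y\<^sup>2 + 1))
      = (real n + 2 * Re b) * (1 + (x / 2)\<^sup>2 * (1 / Im b)\<^sup>2)"
    using ry by algebra
  have "(of_nat n + 2) * U_tilde (n + 2) b x = of_real (r ^ (n + 2)) * ((of_nat n + 2) * ?S (n + 2))"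
    unfolding U_tilde_eq_CRR_scaled[OF x] r_def[symmetric] by (simp only: mult_ac)
  also have "\<dots> = of_real (r * (2 * ((real n + 1 + Re b) * ?y - Im b)))
        * (of_real (r ^ (n + 1)) * ?S (n + 1))
      - of_real (r\<^sup>2 * ((real n + 2 * Re b) * (?y\<^sup>2 + 1))) * (of_real (r ^ n) * ?S n)"
    unfolding CRR_scaled_rec[OF assms(1)] by (simp add: algebra_simps power2_eq_square)
  finally show "(of_nat n + 2) * U_tilde (n + 2) b x
     = of_real (2 * (real n + 1 + Re b) - x) * U_tilde (n + 1) b x
       - of_real ((real n + 2 * Re b) * (1 + (x / 2)\<^sup>2 * (1 / Im b)\<^sup>2)) * U_tilde n b x"
    unfolding c1 c0 U_tilde_eq_CRR_scaled[OF x] r_def[symmetric] .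
qed (auto intro!: continuous_intros)

fun tilde_poly :: "real \<Rightarrow> real \<Rightarrow> nat \<Rightarrow> real poly" where
  "tilde_poly lam x 0 = 1"
| "tilde_poly lam x (Suc 0) = [:2 * lam - x:]"
| "tilde_poly lam x (Suc (Suc n)) =
     smult ((2 * (real n + 1 + lam) - x) / (real n + 2)) (tilde_poly lam x (Suc n))
     - smult ((real n + 2 * lam) / (real n + 2)) ([:1, 0, (x / 2)\<^sup>2:] * tilde_poly lam x n)"

lemma U_tilde_eq_poly:
  assumes "lam > 0" "\<eta> \<noteq> 0"
  shows "U_tilde n (Complex lam \<eta>) x = of_real (poly (tilde_poly lam x n) (1 / \<eta>))"
  using assms
proof (induction lam x n rule: tilde_poly.induct)
  case (1 lam x)
  then show ?case by (simp add: U_tilde_0)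
next
  case (2 lam x)
  then show ?case using U_tilde_1[of "Complex lam \<eta>" x] by simp
next
  case (3 lam x n)
  have nz: "real n + 2 \<noteq> 0" by simp
  have "(real n + 2) * poly (tilde_poly lam x (Suc (Suc n))) h
      = (2 * (real n + 1 + lam) - x) * poly (tilde_poly lam x (Suc n)) h
        - (real n + 2 * lam) * (1 + (x / 2)\<^sup>2 * h\<^sup>2) * poly (tilde_poly lam x n) h" for h
  proof -
    have q: "poly [:1, 0, (x / 2)\<^sup>2:] h = 1 + (x / 2)\<^sup>2 * h\<^sup>2"
      by (simp add: power2_eq_square)
    show ?thesis
      unfolding tilde_poly.simps poly_diff poly_smult poly_mult q right_diff_distrib
      using nz by simp
  qed
  from arg_cong[OF this[of "1 / \<eta>"], of complex_of_real]
  have "(of_nat n + 2) * U_tilde (n + 2) (Complex lam \<eta>) x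
      = (of_nat n + 2) * of_real (poly (tilde_poly lam x (Suc (Suc n))) (1 / \<eta>))"
    using U_tilde_rec[of "Complex lam \<eta>" n x] 3 by simp
  then show ?case
    using of_nat_plus_nonzero(2)[of n, where ?'a = complex] by simp
qed

lemma coeff_tilde_poly_0: "coeff (tilde_poly lam x n) 0 = Laguerre n (2 * lam - 1) x"
proof (induction lam x n rule: tilde_poly.induct)
  case (3 lam x n)
  have nz: "real n + 2 \<noteq> 0" by simp
  have "2 + (2 * lam - 1 - 1 - x) / real (Suc (Suc n)) = (2 * (real n + 1 + lam) - x) / (real n + 2)"
    "1 + (2 * lam - 1 - 1) / real (Suc (Suc n)) = (real n + 2 * lam) / (real n + 2)"
    using nz by (simp_all add: field_simps)
  then show ?case using 3 by (simp add: coeff_mult_0)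
qed simp_all

text \<open>Only \<open>h\<^sup>2\<close> occurs in the recurrence, so there is no linear term.\<close>
lemma coeff_tilde_poly_1: "coeff (tilde_poly lam x n) 1 = 0"
  by (induction lam x n rule: tilde_poly.induct) simp_all

section \<open>The expansions\<close>

lemma poly_split_order_2:
  fixes p :: "'a::comm_ring_1 poly"
  shows "poly p h = coeff p 0 + coeff p 1 * h + h\<^sup>2 * poly (poly_shift 2 p) h"
proof -
  obtain a q where p: "p = pCons a q" by (cases p)
  obtain a' r where q: "q = pCons a' r" by (cases q)
  have "poly_shift 2 p = r"
    by (rule poly_eqI) (simp add: coeff_poly_shift p q)
  then show ?thesis by (simp add: p q algebra_simps power2_eq_square)
qed

theorem theorem4p1:
  fixes n :: nat and x :: real
  shows
    "(\<forall>\<eta>::real. \<exists>R :: real poly. \<forall>lam::real. lam > 0 \<longrightarrow>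
        U_hat n (Complex lam \<eta>) x =
          complex_of_real (Hermite n x - 2 * \<eta> * real n * Hermite (n - 1) x * (1 / sqrt lam)
                           + (1 / sqrt lam) ^ 2 * poly R (1 / sqrt lam)))
     \<and>
     (\<forall>lam::real. lam > 0 \<longrightarrow> (\<exists>R :: real poly. \<forall>\<eta>::real. \<eta> \<noteq> 0 \<longrightarrow>
        U_tilde n (Complex lam \<eta>) x =
          complex_of_real (Laguerre n (2 * lam - 1) x + (1 / \<eta>) ^ 2 * poly R (1 / \<eta>))))"
proof (intro conjI allI impI)
  fix \<eta> :: real
  show "\<exists>R :: real poly. \<forall>lam::real. lam > 0 \<longrightarrow>
        U_hat n (Complex lam \<eta>) x =
          complex_of_real (Hermite n x - 2 * \<eta> * real n * Hermite (n - 1) x * (1 / sqrt lam)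
                           + (1 / sqrt lam) ^ 2 * poly R (1 / sqrt lam))"
    by (intro exI[of _ "poly_shift 2 (hat_poly \<eta> x n)"] allI impI)
      (simp only: U_hat_eq_poly poly_split_order_2[of "hat_poly \<eta> x n"]
        coeff_hat_poly_0 coeff_hat_poly_1, simp)
next
  fix lam :: real assume "lam > 0"
  then show "\<exists>R :: real poly. \<forall>\<eta>::real. \<eta> \<noteq> 0 \<longrightarrow>
        U_tilde n (Complex lam \<eta>) x =
          complex_of_real (Laguerre n (2 * lam - 1) x + (1 / \<eta>) ^ 2 * poly R (1 / \<eta>))"
    by (intro exI[of _ "poly_shift 2 (tilde_poly lam x n)"] allI impI)
      (simp only: U_tilde_eq_poly poly_split_order_2[of "tilde_poly lam x n"]
        coeff_tilde_poly_0 coeff_tilde_poly_1 not_False_eq_True, simp)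
qed

end
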